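(* For every distribution $\nu$ on $[0,1]$ (no density assumption) and every time horizon $T\in\mathbb N$, the regret of the Follow-the-$\rho$ algorithm satisfies \[R_T\le\frac12+4\big(3\sqrt\pi+\sqrt2\big)\sqrt{T-1}.\]
   Context: Brokerage setting: for $p,v_1,v_2\in[0,1]$ let $\mathrm{gft}(p,v_1,v_2):=(v_1\vee v_2-v_1\wedge v_2)\,\mathbb I\{v_1\wedge v_2\le p\le v_1\vee v_2\}$ ($\vee,\wedge$ = max, min). Valuations $V_1,V_2,\dots$ are i.i.d. with law $\nu$; at round $t$ the learner posts $P_t\in[0,1]$, obtains $\mathrm{GFT}_t(P_t)$ with $\mathrm{GFT}_t(q):=\mathrm{gft}(q,V_{2t-1},V_{2t})$, and (full feedback) observes $V_{2t-1},V_{2t}$. Regret: $R_T:=\sup_{p}\mathbb E[\sum_{t=1}^T\mathrm{GFT}_t(p)]-\mathbb E[\sum_{t=1}^T\mathrm{GFT}_t(P_t)]$. For a probability measure $\mu$ on $[0,1]$ let $\bar\mu:=\int x\,\mathrm d\mu(x)$, $\tilde\rho(\mu)(p):=\int_0^p(\mu[0,\lambda]+\mu[0,\lambda))\,\mathrm d\lambda+(\mu[0,p]+\mu[0,p))(\bar\mu-p)$ and $\rho(\mu)(p):=\tilde\rho(\mu)(p)+\mu\{p\}\big(\int_0^p\mu[0,\lambda]\,\mathrm d\lambda+\int_p^1\mu[\lambda,1]\,\mathrm d\lambda\big)$. The Follow-the-$\rho$ (FT$\rho$) algorithm posts $P_1:=1/2$ and, for $t\ge2$, posts $P_t\in\arg\max_{p\in[0,1]}\rho(\hat\nu_t)(p)$,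 where $\hat\nu_t:=\frac1{2(t-1)}\sum_{s=1}^{2(t-1)}\delta_{V_s}$ is the empirical measure of past valuations ($\delta_x$ the Dirac measure at $x$). *)

theory Defs
  imports "HOL-Probability.Probability"
begin

definition gft :: "real \<Rightarrow> real \<Rightarrow> real \<Rightarrow> real" where
  "gft p v1 v2 = (if min v1 v2 \<le> p \<and> p \<le> max v1 v2 then max v1 v2 - min v1 v2 else 0)"

definition mean_of :: "real measure \<Rightarrow> real" where
  "mean_of \<mu> = (\<integral>x. x \<partial>\<mu>)"

definition rho_tilde :: "real measure \<Rightarrow> real \<Rightarrow> real" where
  "rho_tilde \<mu> p =
     integral {0..p} (\<lambda>l. measure \<mu> {..l} + measure \<mu> {..<l})
     + (measure \<mu> {..p} + measure \<mu> {..<p}) * (mean_of \<mu> - p)"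

definition rho :: "real measure \<Rightarrow> real \<Rightarrow> real" where
  "rho \<mu> p = rho_tilde \<mu> p
     + measure \<mu> {p} * (integral {0..p} (\<lambda>l. measure \<mu> {..l})
                         + integral {p..1} (\<lambda>l. measure \<mu> {l..}))"

definition emp :: "real list \<Rightarrow> real measure" where
  "emp xs = measure_pmf (pmf_of_multiset (mset xs))"

definition ftrho_selection :: "(real list \<Rightarrow> real) \<Rightarrow> bool" where
  "ftrho_selection sel \<longleftrightarrow>
     (\<forall>xs. xs \<noteq> [] \<and> even (length xs) \<and> set xs \<subseteq> {0..1} \<longrightarrow>
        sel xs \<in> {0..1} \<and> (\<forall>q\<in>{0..1}. rho (emp xs) q \<le> rho (emp xs) (sel xs)))"

text \<open>Price posted by FT-rho at round t (t \<ge> 1) given the valuation sequence v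
  (valuations indexed from 1): P_1 = 1/2, P_t = sel [v 1, ..., v (2(t-1))].\<close>
definition ftrho_price :: "(real list \<Rightarrow> real) \<Rightarrow> nat \<Rightarrow> (nat \<Rightarrow> real) \<Rightarrow> real" where
  "ftrho_price sel t v = (if t \<le> 1 then 1/2 else sel (map v [1..<2*t-1]))"

text \<open>Regret, with V_1, V_2, ... i.i.d. nu realised as coordinates of the product measure.\<close>
definition regret :: "real measure \<Rightarrow> (nat \<Rightarrow> (nat \<Rightarrow> real) \<Rightarrow> real) \<Rightarrow> nat \<Rightarrow> real" where
  "regret \<nu> P T =
     (SUP p\<in>{0..1}. \<integral>v. (\<Sum>t=1..T. gft p (v (2*t-1)) (v (2*t))) \<partial>(PiM UNIV (\<lambda>_::nat. \<nu>)))
     - (\<integral>v. (\<Sum>t=1..T. gft (P t v) (v (2*t-1)) (v (2*t))) \<partial>(PiM UNIV (\<lambda>_::nat. \<nu>)))"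

end

theory Submission
  imports Defs
begin

text \<open>For \<open>p \<in> [0,1]\<close> the value \<open>\<rho>(\<mu>)(p)\<close> is the expected gain from trade at price \<open>p\<close> of two independent
  \<open>\<mu>\<close>-distributed traders, and it moves by at most \<open>4 D\<close> when the distribution function of \<open>\<mu>\<close> moves
  by at most \<open>D\<close> uniformly. As \<open>P\<^sub>t\<close> maximizes \<open>\<rho>(\<nu>\<^sub>t)\<close> for the empirical measure \<open>\<nu>\<^sub>t\<close> of \<open>n = 2(t-1)\<close>
  valuations, the regret of round \<open>t\<close> against a fixed \<open>p\<close> is at most
  \<open>E[\<rho>(\<nu>)(p) - \<rho>(\<nu>\<^sub>t)(p)] + 4 E[D\<^sub>n]\<close>, \<open>D\<^sub>n\<close> being the Kolmogorov--Smirnov distance. The first term is a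
  bias of order \<open>1/n\<close>. For the second, symmetrization with a ghost sample reduces \<open>E[D\<^sub>n]\<close> to the
  expected running maximum of a simple random walk with \<open>n\<close> steps (take the sample in increasing
  order), which is at most \<open>2 sqrt n\<close>; hence \<open>E[D\<^sub>n] \<le> 4 / sqrt n\<close>. This replaces the
  Dvoretzky--Kiefer--Wolfowitz inequality and still fits within the stated constant.\<close>

section \<open>A maximal inequality for Rademacher sums\<close>

text \<open>Sign vectors on \<open>I\<close> are encoded as subsets of \<open>I\<close>, so a
  Rademacher expectation is a sum over \<open>Pow I\<close> divided by
  \<open>2 ^ card I\<close>.\<close>

definition rsign :: "'a set \<Rightarrow> 'a \<Rightarrow> real" where
  "rsign S i = (if i \<in> S then 1 else -1)"

lemma sum_Pow_insert:
  fixes f :: "'a set \<Rightarrow> 'b :: comm_monoid_add"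
  assumes "finite I" "a \<notin> I"
  shows "(\<Sum>S\<in>Pow (insert a I). f S) = (\<Sum>S\<in>Pow I. f S + f (insert a S))"
proof -
  have "(\<Sum>S\<in>Pow (insert a I). f S) = (\<Sum>S\<in>Pow I. f S) + (\<Sum>S\<in>insert a ` Pow I. f S)"
    unfolding Pow_insert using assms by (intro sum.union_disjoint) auto
  also have "(\<Sum>S\<in>insert a ` Pow I. f S) = (\<Sum>S\<in>Pow I. f (insert a S))"
    using assms by (subst sum.reindex) (auto simp: inj_on_def)
  finally show ?thesis by (simp add: sum.distrib)
qed

lemma sum_rsign_insert:
  assumes "a \<notin> I"
  shows "(\<Sum>i\<in>{i\<in>I. P i}. rsign (insert a S) i) = (\<Sum>i\<in>{i\<in>I. P i}. rsign S i)"
  using assms by (intro sum.cong) (auto simp: rsign_def)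

text \<open>Variance of a simple random walk: a new sign turns s^2 into (s - 1)^2 + (s + 1)^2 = 2
  s^2 + 2.\<close>

lemma sum_rsign_square:
  assumes "finite I"
  shows "(\<Sum>S\<in>Pow I. (\<Sum>i\<in>I. rsign S i)\<^sup>2) = real (card I) * 2 ^ card I"
  using assms
proof (induction I)
  case (insert a I)
  have eq: "(\<Sum>i\<in>insert a I. rsign S i) = (\<Sum>i\<in>I. rsign S i) - 1"
      "(\<Sum>i\<in>insert a I. rsign (insert a S) i) = (\<Sum>i\<in>I. rsign S i) + 1" if "S \<subseteq> I" for S
    using insert.hyps that sum_rsign_insert[of a I S "\<lambda>_. True"] by (auto simp: rsign_def)
  have "(\<Sum>S\<in>Pow (insert a I). (\<Sum>i\<in>insert a I. rsign S i)\<^sup>2)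
      = (\<Sum>S\<in>Pow I. 2 * (\<Sum>i\<in>I. rsign S i)\<^sup>2 + 2)"
    unfolding sum_Pow_insert[OF insert.hyps]
    by (intro sum.cong) (auto simp: eq power2_eq_square algebra_simps)
  also have "\<dots> = real (card (insert a I)) * 2 ^ card (insert a I)"
    using insert by (simp add: sum.distrib card_Pow algebra_simps flip: sum_distrib_left)
  finally show ?case .
qed simp

text \<open>The one-step form of Doob's \<open>L\<^sup>2\<close> inequality for the submartingale \<open>\<bar>s\<bar>\<close> with running
  maximum \<open>M\<close>: the quantity \<open>2 M \<bar>s\<bar> - M\<^sup>2\<close> does not decrease on average.\<close>
lemma maximal_step:
  fixes M s :: real
  assumes "M \<ge> 0"
  shows "2 * max M \<bar>s - 1\<bar> * \<bar>s - 1\<bar> - (max M \<bar>s - 1\<bar>)\<^sup>2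
       + (2 * max M \<bar>s + 1\<bar> * \<bar>s + 1\<bar> - (max M \<bar>s + 1\<bar>)\<^sup>2) \<ge> 2 * (2 * M * \<bar>s\<bar> - M\<^sup>2)"
proof -
  \<comment> \<open>Equality if r is at most M; otherwise the left side is r^2 and the claim reads
    (M - r)^2 >= 0.\<close>
  have *: "2 * max M r * r - (max M r)\<^sup>2 \<ge> 2 * M * r - M\<^sup>2" for r
    using zero_le_power2[of "M - r"] by (auto simp: max_def power2_eq_square algebra_simps)
  have "2 * M * (\<bar>s - 1\<bar> + \<bar>s + 1\<bar>) \<ge> 2 * M * (2 * \<bar>s\<bar>)"
    using assms by (intro mult_left_mono) auto
  with *[of "\<bar>s - 1\<bar>"] *[of "\<bar>s + 1\<bar>"] show ?thesis by (simp add: algebra_simps)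
qed

text \<open>\<open>M S\<close> is the running maximum of the walk that visits \<open>I\<close> in
  increasing order of \<open>x\<close>. With ties it may exceed the supremum over thresholds, which
  is harmless for an upper bound. The last conjunct is the sum of the one-step inequalities
  \<open>maximal_step\<close>.\<close>

lemma rademacher_maximal_aux:
  fixes x :: "'a \<Rightarrow> real"
  assumes "finite I"
  shows "\<exists>M :: 'a set \<Rightarrow> real. (\<forall>S. M S \<ge> 0) \<and>
    (\<forall>S\<subseteq>I. \<forall>q. \<bar>\<Sum>i\<in>{i\<in>I. x i \<le> q}. rsign S i\<bar> \<le> M S) \<and>
    (\<Sum>S\<in>Pow I. (M S)\<^sup>2) \<le> (\<Sum>S\<in>Pow I. 2 * M S * \<bar>\<Sum>i\<in>I. rsign S i\<bar>)"
  using assms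
\<comment> \<open>Each new \<open>a\<close> has the largest value of \<open>x\<close> so far: a
  threshold either takes in all of \<open>insert a I\<close> or leaves \<open>a\<close> out.\<close>
proof (induction I rule: finite_ranking_induct[where f = x])
  case empty
  show ?case by (rule exI[of _ "\<lambda>_. 0"]) auto
next
  case (insert a I)
  show ?case
  proof (cases "a \<in> I")
    case True
    with insert.IH show ?thesis by (simp add: insert_absorb)
  next
    case False
    from insert.IH obtain M :: "'a set \<Rightarrow> real" where M0: "\<And>S. M S \<ge> 0"
      and M: "\<And>S q. S \<subseteq> I \<Longrightarrow> \<bar>\<Sum>i\<in>{i\<in>I. x i \<le> q}. rsign S i\<bar> \<le> M S"
      and M2: "(\<Sum>S\<in>Pow I. (M S)\<^sup>2) \<le> (\<Sum>S\<in>Pow I. 2 * M S * \<bar>\<Sum>i\<in>I. rsign S i\<bar>)"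
      by blast
    define s where "s J S = (\<Sum>i\<in>J. rsign S i)" for J S :: "'a set"
    \<comment> \<open>The old maximum must ignore the sign of \<open>a\<close>, hence the argument
      \<open>S - {a}\<close>.\<close>
    define M' where "M' S = max (M (S - {a})) \<bar>s (insert a I) S\<bar>" for S
    have s: "s (insert a I) S = s I S - 1" "s (insert a I) (insert a S) = s I S + 1" if "S \<subseteq> I" for S
      using \<open>finite I\<close> False that sum_rsign_insert[of a I S "\<lambda>_. True"]
      by (auto simp: rsign_def s_def)
    have bound: "\<bar>\<Sum>i\<in>{i\<in>insert a I. x i \<le> q}. rsign S i\<bar> \<le> M' S" if "S \<subseteq> insert a I" for S q
    proof (cases "x a \<le> q")
      case True
      then have "{i\<in>insert a I. x i \<le> q} = insert a I"
        using insert.hyps(2) order_trans by blast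
      then show ?thesis by (simp only: M'_def s_def max.cobounded2)
    next
      case ge: False
      then have "{i\<in>insert a I. x i \<le> q} = {i\<in>I. x i \<le> q}" by auto
      moreover have "(\<Sum>i\<in>{i\<in>I. x i \<le> q}. rsign S i) = (\<Sum>i\<in>{i\<in>I. x i \<le> q}. rsign (S - {a}) i)"
        using False by (intro sum.cong) (auto simp: rsign_def)
      moreover have "S - {a} \<subseteq> I" using that by auto
      ultimately show ?thesis using M[of "S - {a}" q] by (simp add: M'_def max.coboundedI1)
    qed
    have M'_eq: "M' S = max (M S) \<bar>s I S - 1\<bar>" "M' (insert a S) = max (M S) \<bar>s I S + 1\<bar>"
      if "S \<subseteq> I" for S
    proof -
      have "S - {a} = S" using that False by auto
      then show "M' S = max (M S) \<bar>s I S - 1\<bar>" "M' (insert a S) = max (M S) \<bar>s I S + 1\<bar>"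
        using s[OF that] by (simp_all add: M'_def)
    qed
    \<comment> \<open>The induction hypothesis in the form preserved by \<open>maximal_step\<close>;
      the factor 2 matches the two signs of \<open>a\<close>.\<close>
    have "0 \<le> (\<Sum>S\<in>Pow I. 2 * (2 * M S * \<bar>s I S\<bar> - (M S)\<^sup>2))"
      unfolding sum_distrib_left[symmetric] sum_subtractf s_def using M2 by simp
    also have "\<dots> \<le> (\<Sum>S\<in>Pow I. 2 * M' S * \<bar>s (insert a I) S\<bar> - (M' S)\<^sup>2
        + (2 * M' (insert a S) * \<bar>s (insert a I) (insert a S)\<bar> - (M' (insert a S))\<^sup>2))"
    proof (intro sum_mono, goal_cases)
      case (1 S)
      then have "S \<subseteq> I" by simp
      show ?case unfolding M'_eq[OF \<open>S \<subseteq> I\<close>] s[OF \<open>S \<subseteq> I\<close>] by (rule maximal_step[OF M0])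
    qed
    also have "\<dots> = (\<Sum>S\<in>Pow (insert a I). 2 * M' S * \<bar>s (insert a I) S\<bar> - (M' S)\<^sup>2)"
      using \<open>finite I\<close> False by (simp add: sum_Pow_insert)
    finally have "(\<Sum>S\<in>Pow (insert a I). (M' S)\<^sup>2)
        \<le> (\<Sum>S\<in>Pow (insert a I). 2 * M' S * \<bar>\<Sum>i\<in>insert a I. rsign S i\<bar>)"
      by (simp add: sum_subtractf s_def)
    moreover have "M' S \<ge> 0" for S by (simp add: M'_def max.coboundedI1 M0)
    ultimately show ?thesis using bound by blast
  qed
qed

text \<open>With n = \<open>card I\<close>, averaging over signs gives E M^2 <= 2 E M|s| <= E M^2 /
  2 + 2 E s^2, so E M^2 <= 4 n and E M <= 2 sqrt n.\<close>

lemma rademacher_maximal: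
  fixes x :: "'a \<Rightarrow> real"
  assumes "finite I" "Q \<noteq> {}"
  shows "(\<Sum>S\<in>Pow I. SUP q\<in>Q. \<bar>\<Sum>i\<in>{i\<in>I. x i \<le> q}. rsign S i\<bar>)
           \<le> 2 ^ card I * (2 * sqrt (card I))"
proof (cases "I = {}")
  case True
  then show ?thesis using assms by simp
next
  case False
  obtain M :: "'a set \<Rightarrow> real" where M0: "\<And>S. M S \<ge> 0"
    and M: "\<And>S q. S \<subseteq> I \<Longrightarrow> \<bar>\<Sum>i\<in>{i\<in>I. x i \<le> q}. rsign S i\<bar> \<le> M S"
    and M2: "(\<Sum>S\<in>Pow I. (M S)\<^sup>2) \<le> (\<Sum>S\<in>Pow I. 2 * M S * \<bar>\<Sum>i\<in>I. rsign S i\<bar>)"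
    using rademacher_maximal_aux[OF assms(1), of x] by blast
  define c where "c = sqrt (card I)"
  have c: "c > 0" "c\<^sup>2 = card I" using False assms by (auto simp: c_def card_gt_0_iff)
  note M2
  also have "(\<Sum>S\<in>Pow I. 2 * M S * \<bar>\<Sum>i\<in>I. rsign S i\<bar>)
      \<le> (\<Sum>S\<in>Pow I. (M S)\<^sup>2 / 2 + 2 * (\<Sum>i\<in>I. rsign S i)\<^sup>2)"
  proof (intro sum_mono)
    fix S
    have "0 \<le> (M S - 2 * \<bar>\<Sum>i\<in>I. rsign S i\<bar>)\<^sup>2 / 2" by simp
    also have "\<dots> = (M S)\<^sup>2 / 2 + 2 * (\<Sum>i\<in>I. rsign S i)\<^sup>2 - 2 * M S * \<bar>\<Sum>i\<in>I. rsign S i\<bar>"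
      by (simp add: power2_diff power_mult_distrib field_simps)
    finally show "2 * M S * \<bar>\<Sum>i\<in>I. rsign S i\<bar> \<le> (M S)\<^sup>2 / 2 + 2 * (\<Sum>i\<in>I. rsign S i)\<^sup>2" by simp
  qed
  also have "\<dots> = (\<Sum>S\<in>Pow I. (M S)\<^sup>2) / 2 + 2 * (c\<^sup>2 * 2 ^ card I)"
    using sum_rsign_square[OF assms(1)]
    by (simp add: c sum.distrib flip: sum_distrib_left sum_divide_distrib)
  finally have le: "(\<Sum>S\<in>Pow I. (M S)\<^sup>2) \<le> 4 * c\<^sup>2 * 2 ^ card I" by simp
  have "(\<Sum>S\<in>Pow I. SUP q\<in>Q. \<bar>\<Sum>i\<in>{i\<in>I. x i \<le> q}. rsign S i\<bar>) \<le> (\<Sum>S\<in>Pow I. M S)"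
    using M assms(2) by (intro sum_mono cSUP_least) auto
  \<comment> \<open>This linearization of the square root at 4 c^2 takes the place of
    Cauchy-Schwarz.\<close>
  also have "\<dots> \<le> (\<Sum>S\<in>Pow I. (M S)\<^sup>2 / (4 * c) + c)"
  proof (intro sum_mono)
    fix S
    have "0 \<le> (M S - 2 * c)\<^sup>2 / (4 * c)" using c by simp
    also have "\<dots> = (M S)\<^sup>2 / (4 * c) + c - M S" using c by (simp add: field_simps power2_eq_square)
    finally show "M S \<le> (M S)\<^sup>2 / (4 * c) + c" by simp
  qed
  also have "\<dots> = (\<Sum>S\<in>Pow I. (M S)\<^sup>2) / (4 * c) + 2 ^ card I * c"
    using assms by (simp add: sum.distrib card_Pow flip: sum_divide_distrib)
  also have "\<dots> \<le> (4 * c\<^sup>2 * 2 ^ card I) / (4 * c) + 2 ^ card I * c"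
    using le c by (intro add_right_mono divide_right_mono) auto
  also have "\<dots> = 2 ^ card I * (2 * c)" using c(1) by (simp add: power2_eq_square)
  finally show ?thesis by (simp add: c_def)
qed

section \<open>Expected gain from trade and the function rho\<close>

text \<open>A law on [0,1] is kept as a Borel law on the whole line, so that \<open>cdf\<close>
  applies to the true and to the empirical distribution alike.\<close>

locale unit_distribution = real_distribution M for M +
  assumes AE_unit: "AE x in M. x \<in> {0..1}"
begin

lemma integrable_bounded_on_unit:
  fixes f :: "real \<Rightarrow> real"
  assumes "f \<in> borel_measurable borel" "\<And>x. x \<in> {0..1} \<Longrightarrow> \<bar>f x\<bar> \<le> B"
  shows "integrable M f"
proof (rule integrable_const_bound)
  show "AE x in M. norm (f x) \<le> B"
    using AE_unit assms(2) by (auto elim: eventually_mono)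
qed (use assms(1) in simp)

text \<open>Fubini for the indicator of the set of pairs (l, x) with l in [a,b] and
  \<open>P l x\<close>: integrated probabilities become expected lengths.\<close>

lemma integral_prob_section:
  fixes P :: "real \<Rightarrow> real \<Rightarrow> bool"
  assumes [measurable]: "Measurable.pred (borel \<Otimes>\<^sub>M borel) (\<lambda>z. P (fst z) (snd z))"
  shows "(\<lambda>l. prob {x. P l x}) integrable_on {a..b}"
    and "integral {a..b} (\<lambda>l. prob {x. P l x}) = (\<integral>x. measure lborel {l\<in>{a..b}. P l x} \<partial>M)"
proof -
  interpret L: pair_sigma_finite lborel M ..
  let ?f = "\<lambda>l x. indicator {(l, x). l \<in> {a..b} \<and> P l x} (l, x) :: real"
  have meas: "{(l, x). l \<in> {a..b} \<and> P l x} \<in> sets (lborel \<Otimes>\<^sub>M M)"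
  proof -
    have "Measurable.pred (lborel \<Otimes>\<^sub>M M) (\<lambda>z. fst z \<in> {a..b} \<and> P (fst z) (snd z))"
      by measurable
    then show ?thesis by (simp add: pred_def space_pair_measure case_prod_beta')
  qed
  have le: "emeasure (lborel \<Otimes>\<^sub>M M) {(l, x). l \<in> {a..b} \<and> P l x} \<le> emeasure (lborel \<Otimes>\<^sub>M M) ({a..b} \<times> UNIV)"
    by (intro emeasure_mono) auto
  also have "\<dots> = emeasure lborel {a..b} * emeasure M UNIV"
    by (intro emeasure_pair_measure_Times) auto
  also have "\<dots> < \<infinity>"
    using emeasure_space_1 by (simp add: emeasure_lborel_Icc_eq)
  finally have int: "integrable (lborel \<Otimes>\<^sub>M M) (case_prod ?f)"
    using meas by (simp add: case_prod_beta')
  have inner: "(\<integral>x. ?f l x \<partial>M) = indicator {a..b} l *\<^sub>R prob {x. P l x}" for l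
  proof -
    have "(\<integral>x. ?f l x \<partial>M) = (\<integral>x. indicator {a..b} l * indicator {x. P l x} x \<partial>M)"
      by (intro Bochner_Integration.integral_cong) (auto simp: indicator_def)
    then show ?thesis by simp
  qed
  have outer: "(\<integral>l. ?f l x \<partial>lborel) = measure lborel {l\<in>{a..b}. P l x}" for x
  proof -
    have "(\<integral>l. ?f l x \<partial>lborel) = (\<integral>l. indicator {l\<in>{a..b}. P l x} l \<partial>lborel)"
      by (intro Bochner_Integration.integral_cong) (auto simp: indicator_def)
    then show ?thesis by simp
  qed
  have "set_integrable lborel {a..b} (\<lambda>l. prob {x. P l x})"
    unfolding set_integrable_def inner[symmetric] using L.integrable_fst'[OF int] by simp
  note * = set_borel_integral_eq_integral[OF this]
  show "(\<lambda>l. prob {x. P l x}) integrable_on {a..b}" by (rule *(1))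
  have "integral {a..b} (\<lambda>l. prob {x. P l x}) = (\<integral>l. (\<integral>x. ?f l x \<partial>M) \<partial>lborel)"
    unfolding inner *(2)[symmetric] set_lebesgue_integral_def ..
  also have "\<dots> = (\<integral>x. (\<integral>l. ?f l x \<partial>lborel) \<partial>M)"
    by (rule L.Fubini_integral[OF int, symmetric])
  also have "\<dots> = (\<integral>x. measure lborel {l\<in>{a..b}. P l x} \<partial>M)"
    by (simp only: outer)
  finally show "integral {a..b} (\<lambda>l. prob {x. P l x}) = (\<integral>x. measure lborel {l\<in>{a..b}. P l x} \<partial>M)" .
qed

text \<open>For p in [0,1] this is the integral over [0,p] of the distribution function, whether its
  rays are closed or open; \<open>upper_gap\<close> plays the same part for the upper tail on
  [p,1].\<close>

definition lower_gap :: "real \<Rightarrow> real" where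
  "lower_gap p = (\<integral>x. max 0 (p - x) \<partial>M)"

definition upper_gap :: "real \<Rightarrow> real" where
  "upper_gap p = (\<integral>x. max 0 (x - p) \<partial>M)"

lemma integral_prob_section_unit:
  fixes P :: "real \<Rightarrow> real \<Rightarrow> bool"
  assumes meas: "Measurable.pred (borel \<Otimes>\<^sub>M borel) (\<lambda>z. P (fst z) (snd z))"
    and h: "h \<in> borel_measurable borel"
    and len: "\<And>x. x \<in> {0..1} \<Longrightarrow> measure lborel {l\<in>{a..b}. P l x} = h x"
  shows "(\<lambda>l. prob {x. P l x}) integrable_on {a..b}"
    and "integral {a..b} (\<lambda>l. prob {x. P l x}) = (\<integral>x. h x \<partial>M)"
proof -
  have [measurable]: "Measurable.pred (M \<Otimes>\<^sub>M lborel) (\<lambda>z. P (snd z) (fst z))"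
    using measurable_compose[OF measurable_pair_swap' meas] by (simp add: case_prod_beta')
  have "(\<lambda>x. measure lborel {l\<in>{a..b}. P l x}) = (\<lambda>x. enn2real (emeasure lborel {l\<in>{a..b}. P l x}))"
    by (simp add: measure_def)
  also have "\<dots> \<in> borel_measurable M"
    by measurable
  finally have "(\<integral>x. measure lborel {l\<in>{a..b}. P l x} \<partial>M) = (\<integral>x. h x \<partial>M)"
    using h AE_unit len by (intro integral_cong_AE) (auto elim: eventually_mono)
  then show "integral {a..b} (\<lambda>l. prob {x. P l x}) = (\<integral>x. h x \<partial>M)"
    using integral_prob_section(2)[OF meas] by simp
qed (rule integral_prob_section(1)[OF meas])

lemma lower_gap_atMost:
  assumes "p \<in> {0..1}"
  shows "(\<lambda>l. prob {..l}) integrable_on {0..p}" "integral {0..p} (\<lambda>l. prob {..l}) = lower_gap p"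
proof -
  have "measure lborel {l\<in>{0..p}. x \<le> l} = max 0 (p - x)" if "x \<in> {0..1}" for x
  proof -
    \<comment> \<open>Nonnegativity of x enters here: otherwise the section would be cut off at
      0.\<close>
    have eq: "{l\<in>{0..p}. x \<le> l} = {x..p}" using that by auto
    show ?thesis unfolding eq by (cases "x \<le> p") simp_all
  qed
  note * = integral_prob_section_unit[of "\<lambda>l x. x \<le> l", OF _ _ this]
  show "(\<lambda>l. prob {..l}) integrable_on {0..p}" "integral {0..p} (\<lambda>l. prob {..l}) = lower_gap p"
    unfolding atMost_def lower_gap_def by (rule *; measurable)+
qed

lemma lower_gap_lessThan:
  assumes "p \<in> {0..1}"
  shows "(\<lambda>l. prob {..<l}) integrable_on {0..p}" "integral {0..p} (\<lambda>l. prob {..<l}) = lower_gap p"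
proof -
  have "measure lborel {l\<in>{0..p}. x < l} = max 0 (p - x)" if "x \<in> {0..1}" for x
  proof -
    have eq: "{l\<in>{0..p}. x < l} = {x<..p}" using that by auto
    show ?thesis unfolding eq by (cases "x \<le> p") simp_all
  qed
  note * = integral_prob_section_unit[of "\<lambda>l x. x < l", OF _ _ this]
  show "(\<lambda>l. prob {..<l}) integrable_on {0..p}" "integral {0..p} (\<lambda>l. prob {..<l}) = lower_gap p"
    unfolding lessThan_def lower_gap_def by (rule *; measurable)+
qed

lemma upper_gap_atLeast:
  assumes "p \<in> {0..1}"
  shows "(\<lambda>l. prob {l..}) integrable_on {p..1}" "integral {p..1} (\<lambda>l. prob {l..}) = upper_gap p"
proof -
  have "measure lborel {l\<in>{p..1}. l \<le> x} = max 0 (x - p)" if "x \<in> {0..1}" for x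
  proof -
    have eq: "{l\<in>{p..1}. l \<le> x} = {p..x}" using that by auto
    show ?thesis unfolding eq by (cases "p \<le> x") simp_all
  qed
  note * = integral_prob_section_unit[of "\<lambda>l x. l \<le> x", OF _ _ this]
  show "(\<lambda>l. prob {l..}) integrable_on {p..1}" "integral {p..1} (\<lambda>l. prob {l..}) = upper_gap p"
    unfolding atLeast_def upper_gap_def by (rule *; measurable)+
qed

lemma prob_atLeast: "prob {p..} = 1 - prob {..<p}"
proof -
  have "UNIV - {..<p} = {p..}" by auto
  with prob_compl[of "{..<p}"] show ?thesis by simp
qed

lemma integrable_gap [simp]:
  "integrable M (\<lambda>x. max 0 (p - x))" "integrable M (\<lambda>x. max 0 (x - p))" "integrable M (\<lambda>x. x)"
  by (rule integrable_bounded_on_unit[where B = "1 + \<bar>p\<bar>"]; force)+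

lemma gap_nonneg: "0 \<le> lower_gap p" "0 \<le> upper_gap p"
  unfolding lower_gap_def upper_gap_def by simp_all

lemma lower_gap_plus_upper_gap_le_1:
  assumes "p \<in> {0..1}"
  shows "lower_gap p + upper_gap p \<le> 1"
proof -
  have "lower_gap p + upper_gap p = (\<integral>x. max 0 (p - x) + max 0 (x - p) \<partial>M)"
    unfolding lower_gap_def upper_gap_def by simp
  also have "\<dots> \<le> (\<integral>x. 1 \<partial>M)"
    by (intro integral_mono_AE eventually_mono[OF AE_unit]) (use assms in auto)
  finally show ?thesis using prob_space by simp
qed

lemma upper_gap_minus_lower_gap: "upper_gap p - lower_gap p = mean_of M - p"
proof -
  have "upper_gap p - lower_gap p = (\<integral>x. max 0 (x - p) - max 0 (p - x) \<partial>M)"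
    unfolding lower_gap_def upper_gap_def by simp
  also have "\<dots> = (\<integral>x. x - p \<partial>M)"
    by (intro Bochner_Integration.integral_cong) auto
  finally show ?thesis using prob_space by (simp add: mean_of_def)
qed

text \<open>Write F, F' for the masses of the closed and open rays at p, and L, U for the gaps. The
  atom is F - F' and the mean minus p is U - L, so rho = 2 L + (F + F')(U - L) + (F - F')(L + U) = 2
  (F U + (1 - F') L).\<close>

lemma rho_eq_gaps:
  assumes p: "p \<in> {0..1}"
  shows "rho M p = 2 * (prob {..p} * upper_gap p + prob {p..} * lower_gap p)"
proof -
  have "{..p} = insert p {..<p}" by auto
  then have atom: "prob {p} = prob {..p} - prob {..<p}"
    using finite_measure_Union[of "{p}" "{..<p}"] by simp
  have "integral {0..p} (\<lambda>l. prob {..l} + prob {..<l}) = 2 * lower_gap p"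
    using integral_add[OF lower_gap_atMost(1)[OF p] lower_gap_lessThan(1)[OF p]]
      lower_gap_atMost(2)[OF p] lower_gap_lessThan(2)[OF p] by simp
  then show ?thesis
    unfolding rho_def rho_tilde_def lower_gap_atMost(2)[OF p] upper_gap_atLeast(2)[OF p]
      atom upper_gap_minus_lower_gap[of p, symmetric]
    by (simp add: prob_atLeast[of p] algebra_simps)
qed

text \<open>A trade needs the valuations on opposite sides of p, and its surplus splits at p into
  two distances. Every summand is a function of x times a function of y, so independence factorizes
  its expectation.\<close>

lemma gft_eq_gaps:
  "gft p x y = indicator {..p} x * max 0 (y - p) + indicator {p..} x * max 0 (p - y)
     + (max 0 (x - p) * indicator {..p} y + max 0 (p - x) * indicator {p..} y)"
  by (auto simp: gft_def indicator_def min_def max_def)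

lemma rho_eq_integral_gft:
  assumes "p \<in> {0..1}"
  shows "rho M p = (\<integral>x. (\<integral>y. gft p x y \<partial>M) \<partial>M)"
proof -
  have "(\<integral>y. gft p x y \<partial>M) = indicator {..p} x * upper_gap p + indicator {p..} x * lower_gap p
     + (max 0 (x - p) * prob {..p} + max 0 (p - x) * prob {p..})" for x
    unfolding gft_eq_gaps upper_gap_def lower_gap_def by (simp add: less_top[symmetric])
  then have "(\<integral>x. (\<integral>y. gft p x y \<partial>M) \<partial>M) = prob {..p} * upper_gap p + prob {p..} * lower_gap p
     + (upper_gap p * prob {..p} + lower_gap p * prob {p..})"
    by (simp add: less_top[symmetric] flip: upper_gap_def lower_gap_def)
  then show ?thesis using rho_eq_gaps[OF assms] by simp
qed

end

section \<open>Stability of \<open>rho\<close> under uniform perturbation of the distribution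
  function\<close>

lemma dense_bound_at_right:
  fixes h :: "real \<Rightarrow> real"
  assumes "(h \<longlongrightarrow> l) (at_right a)" "\<And>q. q \<in> \<rat> \<Longrightarrow> \<bar>h q\<bar> \<le> D"
  shows "\<bar>l\<bar> \<le> D"
proof (rule ccontr)
  assume "\<not> \<bar>l\<bar> \<le> D"
  then have "\<forall>\<^sub>F x in at_right a. D < \<bar>h x\<bar>"
    using order_tendstoD(1)[OF tendsto_rabs[OF assms(1)], of D] by simp
  then obtain b where "a < b" "\<And>y. a < y \<Longrightarrow> y < b \<Longrightarrow> D < \<bar>h y\<bar>"
    by (auto simp: eventually_at_right_field)
  moreover obtain q where "q \<in> \<rat>" "a < q" "q < b"
    using Rats_dense_in_real[OF \<open>a < b\<close>] by blast
  ultimately show False using assms(2)[of q] by force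
qed

lemma dense_bound_at_left:
  fixes h :: "real \<Rightarrow> real"
  assumes "(h \<longlongrightarrow> l) (at_left a)" "\<And>q. q \<in> \<rat> \<Longrightarrow> \<bar>h q\<bar> \<le> D"
  shows "\<bar>l\<bar> \<le> D"
proof (rule ccontr)
  assume "\<not> \<bar>l\<bar> \<le> D"
  then have "\<forall>\<^sub>F x in at_left a. D < \<bar>h x\<bar>"
    using order_tendstoD(1)[OF tendsto_rabs[OF assms(1)], of D] by simp
  then obtain b where "b < a" "\<And>y. b < y \<Longrightarrow> y < a \<Longrightarrow> D < \<bar>h y\<bar>"
    by (auto simp: eventually_at_left_field)
  moreover obtain q where "q \<in> \<rat>" "b < q" "q < a"
    using Rats_dense_in_real[OF \<open>b < a\<close>] by blast
  ultimately show False using assms(2)[of q] by force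
qed

lemma abs_integral_diff_le:
  fixes f g :: "real \<Rightarrow> real"
  assumes "f integrable_on {a..b}" "g integrable_on {a..b}" "\<And>x. \<bar>f x - g x\<bar> \<le> D" "a \<le> b"
  shows "\<bar>integral {a..b} f - integral {a..b} g\<bar> \<le> D * (b - a)"
proof -
  have "((\<lambda>x. f x - g x) has_integral integral {a..b} f - integral {a..b} g) {a..b}"
    using assms by (intro has_integral_diff integrable_integral)
  moreover have "0 \<le> D" using assms(3)[of a] by linarith
  ultimately have "norm (integral {a..b} f - integral {a..b} g) \<le> D * measure lborel {a..b}"
    using assms(3) by (intro has_integral_bound_real[of D]) auto
  then show ?thesis using assms(4) by simp
qed

lemma rho_diff_le:
  assumes M: "unit_distribution M" and N: "unit_distribution N"
    and D: "\<And>q. q \<in> \<rat> \<Longrightarrow> \<bar>cdf M q - cdf N q\<bar> \<le> D" and p: "p \<in> {0..1}"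
  shows "\<bar>rho M p - rho N p\<bar> \<le> 4 * D"
proof -
  interpret M: unit_distribution M by (rule M)
  interpret N: unit_distribution N by (rule N)
  \<comment> \<open>The bound at rationals reaches closed rays through limits from the right and
    open rays through limits from the left.\<close>
  have le: "\<bar>M.prob {..q} - N.prob {..q}\<bar> \<le> D" for q
  proof (rule dense_bound_at_right[OF _ D])
    show "((\<lambda>q. cdf M q - cdf N q) \<longlongrightarrow> M.prob {..q} - N.prob {..q}) (at_right q)"
      using M.cdf_is_right_cont[of q] N.cdf_is_right_cont[of q]
      by (intro tendsto_diff) (simp_all add: continuous_within cdf_def)
  qed
  have less: "\<bar>M.prob {..<q} - N.prob {..<q}\<bar> \<le> D" for q
    using tendsto_diff[OF M.cdf_at_left[of q] N.cdf_at_left[of q]] D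
    by (rule dense_bound_at_left)
  have ge: "\<bar>M.prob {q..} - N.prob {q..}\<bar> \<le> D" for q
    using less[of q] by (simp add: M.prob_atLeast N.prob_atLeast)
  have D0: "0 \<le> D" using le[of 0] by linarith
  have A: "\<bar>M.lower_gap p - N.lower_gap p\<bar> \<le> D * p"
    using abs_integral_diff_le[OF M.lower_gap_atMost(1)[OF p] N.lower_gap_atMost(1)[OF p] le] p
    by (simp add: M.lower_gap_atMost N.lower_gap_atMost)
  have B: "\<bar>M.upper_gap p - N.upper_gap p\<bar> \<le> D * (1 - p)"
    using abs_integral_diff_le[OF M.upper_gap_atLeast(1)[OF p] N.upper_gap_atLeast(1)[OF p] ge] p
    by (simp add: M.upper_gap_atLeast N.upper_gap_atLeast)
  \<comment> \<open>Differences of probabilities are paired with the gaps of \<open>M\<close>, whose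
    sum is at most 1; differences of gaps are paired with probabilities of \<open>N\<close>, and
    contribute D (1 - p) + D p = D.\<close>
  have "\<bar>M.prob {..p} * M.upper_gap p + M.prob {p..} * M.lower_gap p
      - (N.prob {..p} * N.upper_gap p + N.prob {p..} * N.lower_gap p)\<bar>
    = \<bar>(M.prob {..p} - N.prob {..p}) * M.upper_gap p + (M.prob {p..} - N.prob {p..}) * M.lower_gap p
      + N.prob {..p} * (M.upper_gap p - N.upper_gap p) + N.prob {p..} * (M.lower_gap p - N.lower_gap p)\<bar>"
    by (simp add: algebra_simps)
  also have "\<dots> \<le> \<bar>M.prob {..p} - N.prob {..p}\<bar> * M.upper_gap p + \<bar>M.prob {p..} - N.prob {p..}\<bar> * M.lower_gap p
      + N.prob {..p} * \<bar>M.upper_gap p - N.upper_gap p\<bar> + N.prob {p..} * \<bar>M.lower_gap p - N.lower_gap p\<bar>"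
    using M.gap_nonneg[of p]
    by (intro order_trans[OF abs_triangle_ineq] add_mono) (simp_all add: abs_mult)
  also have "\<dots> \<le> D * M.upper_gap p + D * M.lower_gap p + 1 * (D * (1 - p)) + 1 * (D * p)"
    using le[of p] ge[of p] A B M.gap_nonneg[of p] D0 p
    by (intro add_mono mult_mono) auto
  also have "\<dots> = D * (M.lower_gap p + M.upper_gap p) + D" by (simp add: algebra_simps)
  also have "\<dots> \<le> D * 1 + D"
    using M.lower_gap_plus_upper_gap_le_1[OF p] D0 by (intro add_right_mono mult_left_mono)
  finally show ?thesis unfolding M.rho_eq_gaps[OF p] N.rho_eq_gaps[OF p] by simp
qed

section \<open>Empirical measures\<close>

text \<open>In \<open>emp\<close> every set is measurable; pushing it forward to
  \<open>borel\<close> makes it a \<open>real_distribution\<close>.\<close>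

definition emp_borel :: "real list \<Rightarrow> real measure" where
  "emp_borel xs = distr (emp xs) borel (\<lambda>x. x)"

lemma sum_list_map_eq_sum_of_nat_count:
  fixes f :: "'a \<Rightarrow> 'b :: comm_semiring_1"
  shows "sum_list (map f xs) = (\<Sum>x\<in>set xs. of_nat (count_list xs x) * f x)"
proof (induction xs)
  case (Cons a xs)
  have "(\<Sum>x\<in>set (a # xs). of_nat (count_list (a # xs) x) * f x)
      = (\<Sum>x\<in>insert a (set xs). of_nat (count_list xs x) * f x + (if x = a then f a else 0))"
    by (intro sum.cong) (auto simp: algebra_simps)
  also have "\<dots> = (\<Sum>x\<in>insert a (set xs). of_nat (count_list xs x) * f x) + f a"
    by (simp add: sum.distrib)
  also have "(\<Sum>x\<in>insert a (set xs). of_nat (count_list xs x) * f x)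
      = (\<Sum>x\<in>set xs. of_nat (count_list xs x) * f x)"
    by (cases "a \<in> set xs") (auto simp: insert_absorb)
  finally show ?case using Cons by (simp add: add.commute)
qed simp

lemma integral_emp_borel:
  assumes "xs \<noteq> []" "f \<in> borel_measurable borel"
  shows "(\<integral>x. f x \<partial>emp_borel xs) = (\<Sum>i<length xs. f (xs ! i)) / length xs"
proof -
  have "(\<integral>x. f x \<partial>emp_borel xs) = (\<integral>x. f x \<partial>pmf_of_multiset (mset xs))"
    unfolding emp_borel_def emp_def using assms(2) by (subst integral_distr) auto
  also have "\<dots> = (\<Sum>x\<in>set xs. f x * pmf (pmf_of_multiset (mset xs)) x)"
    using assms(1) by (intro integral_measure_pmf_real) auto
  also have "\<dots> = (\<Sum>x\<in>set xs. count_list xs x * f x) / length xs"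
    using assms(1) by (simp add: sum_divide_distrib count_mset mult.commute)
  also have "\<dots> = sum_list (map f xs) / length xs"
    by (simp add: sum_list_map_eq_sum_of_nat_count)
  also have "sum_list (map f xs) = (\<Sum>i<length xs. f (xs ! i))"
    by (simp add: sum_list_sum_nth atLeast0LessThan)
  finally show ?thesis .
qed

lemma measure_emp_borel:
  assumes "A \<in> sets borel"
  shows "measure (emp_borel xs) A = measure (emp xs) A"
  unfolding emp_borel_def using assms by (subst measure_distr) (auto simp: emp_def)

lemma mean_of_emp_borel: "mean_of (emp_borel xs) = mean_of (emp xs)"
  unfolding emp_borel_def mean_of_def by (subst integral_distr) (auto simp: emp_def)

lemma rho_emp_borel: "rho (emp_borel xs) = rho (emp xs)"
  unfolding rho_def rho_tilde_def by (simp add: fun_eq_iff measure_emp_borel mean_of_emp_borel)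

lemma unit_distribution_emp_borel:
  assumes "xs \<noteq> []" "set xs \<subseteq> {0..1}"
  shows "unit_distribution (emp_borel xs)"
proof -
  have "prob_space (emp_borel xs)"
    unfolding emp_borel_def emp_def
    by (intro prob_space.prob_space_distr prob_space_measure_pmf) simp
  moreover have "AE x in emp_borel xs. x \<in> {0..1}"
    unfolding emp_borel_def emp_def using assms
    by (subst AE_distr_iff) (auto simp: AE_measure_pmf_iff)
  moreover have "sets (emp_borel xs) = sets borel"
    by (simp add: emp_borel_def)
  ultimately show ?thesis
    unfolding unit_distribution_def unit_distribution_axioms_def real_distribution_def
      real_distribution_axioms_def by blast
qed

lemma gft_measurable [measurable]:
  assumes [measurable]: "f \<in> borel_measurable N" "g \<in> borel_measurable N" "h \<in> borel_measurable N"
  shows "(\<lambda>x. gft (f x) (g x) (h x)) \<in> borel_measurable N"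
  unfolding gft_def by measurable

text \<open>Two independent draws from the sample, with replacement: a V-statistic, diagonal
  included.\<close>

lemma rho_emp_eq_sum:
  assumes "xs \<noteq> []" "set xs \<subseteq> {0..1}" "p \<in> {0..1}"
  shows "rho (emp xs) p = (\<Sum>i<length xs. \<Sum>j<length xs. gft p (xs ! i) (xs ! j)) / (length xs)\<^sup>2"
proof -
  interpret unit_distribution "emp_borel xs"
    by (rule unit_distribution_emp_borel) fact+
  have "rho (emp xs) p = (\<integral>x. (\<Sum>j<length xs. gft p x (xs ! j)) / length xs \<partial>emp_borel xs)"
    using rho_eq_integral_gft[OF assms(3)] assms(1)
    by (simp add: rho_emp_borel integral_emp_borel)
  also have "\<dots> = (\<Sum>i<length xs. (\<Sum>j<length xs. gft p (xs ! i) (xs ! j)) / length xs) / length xs"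
    using assms(1) by (intro integral_emp_borel) measurable
  finally show ?thesis by (simp add: power2_eq_square flip: sum_divide_distrib)
qed

lemma cdf_emp_borel:
  assumes "xs \<noteq> []"
  shows "cdf (emp_borel xs) q = (\<Sum>i<length xs. indicator {..q} (xs ! i)) / length xs"
proof -
  have "cdf (emp_borel xs) q = (\<integral>x. indicator {..q} x \<partial>emp_borel xs)"
    by (simp add: cdf_def emp_borel_def)
  also have "\<dots> = (\<Sum>i<length xs. indicator {..q} (xs ! i)) / length xs"
    by (rule integral_emp_borel[OF assms]) simp
  finally show ?thesis .
qed

section \<open>Symmetrization of the empirical process\<close>

text \<open>The supremum is restricted to the rationals so that it is a countable one and
  measurable; \<open>rho_diff_le\<close> asks for no more.\<close>

definition rat_sup_norm :: "(real \<Rightarrow> real) \<Rightarrow> real" where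
  "rat_sup_norm h = (SUP q\<in>\<rat>. \<bar>h q\<bar>)"

lemma Rats_nonempty: "(\<rat> :: real set) \<noteq> {}"
  using Rats_0 by blast

lemma rat_sup_norm_upper:
  assumes "\<And>q. \<bar>h q\<bar> \<le> B" "q \<in> \<rat>"
  shows "\<bar>h q\<bar> \<le> rat_sup_norm h"
  unfolding rat_sup_norm_def using assms by (intro cSUP_upper bdd_aboveI2) auto

lemma rat_sup_norm_least:
  assumes "\<And>q. q \<in> \<rat> \<Longrightarrow> \<bar>h q\<bar> \<le> B"
  shows "rat_sup_norm h \<le> B"
  unfolding rat_sup_norm_def using assms Rats_nonempty by (intro cSUP_least) auto

lemma rat_sup_norm_nonneg:
  assumes "\<And>q. \<bar>h q\<bar> \<le> B"
  shows "0 \<le> rat_sup_norm h"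
  using rat_sup_norm_upper[of h B 0, OF assms] by force

lemma borel_measurable_rat_sup_norm:
  assumes "\<And>q. (\<lambda>x. f x q) \<in> borel_measurable N" "\<And>x q. \<bar>f x q\<bar> \<le> B"
  shows "(\<lambda>x. rat_sup_norm (f x)) \<in> borel_measurable N"
  unfolding rat_sup_norm_def using assms
  by (intro borel_measurable_cSUP bdd_aboveI2[of _ _ B]) (auto simp: countable_rat)

lemma (in prob_space) integrable_rat_sup_norm:
  assumes "\<And>q. (\<lambda>x. f x q) \<in> borel_measurable M" "\<And>x q. \<bar>f x q\<bar> \<le> B"
  shows "integrable M (\<lambda>x. rat_sup_norm (f x))"
proof (rule integrable_const_bound)
  have "\<bar>rat_sup_norm (f x)\<bar> \<le> B" for x
    using rat_sup_norm_nonneg[of "f x" B] rat_sup_norm_least[of "f x" B] assms(2) by simp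
  then show "AE x in M. norm (rat_sup_norm (f x)) \<le> B" by simp
qed (rule borel_measurable_rat_sup_norm[OF assms])

section \<open>Reindexing and splitting of i.i.d. sequences\<close>

context real_distribution
begin

abbreviation Seq :: "(nat \<Rightarrow> real) measure" where
  "Seq \<equiv> Pi\<^sub>M UNIV (\<lambda>_. M)"

sublocale seq: sequence_space M ..

lemma measurable_Seq_component [measurable (raw)]:
  assumes "f \<in> measurable N Seq"
  shows "(\<lambda>x. f x i) \<in> borel_measurable N"
proof -
  have "(\<lambda>x. f x i) \<in> measurable N M"
    using measurable_component_singleton[OF UNIV_I] assms by (rule measurable_compose[rotated])
  then show ?thesis by (simp add: measurable_cong_sets[OF refl events_eq_borel])
qed

lemma measurable_Seq_reindex: "(\<lambda>v n. v (\<sigma> n)) \<in> measurable Seq Seq"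
  by (intro measurable_PiM_single') (auto simp: space_PiM)

text \<open>Distinct coordinates of an i.i.d. sequence, in any order, again form an i.i.d. sequence
  of the same law.\<close>

lemma integral_Seq_reindex:
  fixes f :: "(nat \<Rightarrow> real) \<Rightarrow> real"
  assumes "inj \<sigma>" "f \<in> borel_measurable Seq"
  shows "(\<integral>v. f (\<lambda>n. v (\<sigma> n)) \<partial>Seq) = (\<integral>v. f v \<partial>Seq)"
proof -
  have "distr Seq Seq (\<lambda>v. \<lambda>n\<in>UNIV. v (\<sigma> n)) = Seq"
    using assms(1) by (intro distr_PiM_reindex prob_space_axioms) auto
  then have eq: "distr Seq Seq (\<lambda>v n. v (\<sigma> n)) = Seq"
    by (simp only: restrict_UNIV)
  have "(\<integral>v. f v \<partial>Seq) = (\<integral>v. f v \<partial>distr Seq Seq (\<lambda>v n. v (\<sigma> n)))"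
    by (simp only: eq)
  also have "\<dots> = (\<integral>v. f (\<lambda>n. v (\<sigma> n)) \<partial>Seq)"
    using measurable_Seq_reindex assms(2) by (rule integral_distr)
  finally show ?thesis ..
qed

text \<open>Independence of past and future: \<open>comb_seq k v w\<close> takes its first
  \<open>k\<close> terms from \<open>v\<close> and continues with \<open>w\<close> from its start.
  The rest is Fubini.\<close>

lemma integral_Seq_comb_seq:
  fixes f :: "(nat \<Rightarrow> real) \<Rightarrow> real"
  assumes "integrable Seq f"
  shows "(\<integral>v. f v \<partial>Seq) = (\<integral>v. (\<integral>w. f (comb_seq k v w) \<partial>Seq) \<partial>Seq)"
    and "integrable Seq (\<lambda>v. \<integral>w. f (comb_seq k v w) \<partial>Seq)"
proof -
  interpret P: pair_prob_space Seq Seq ..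
  have "integrable (Seq \<Otimes>\<^sub>M Seq) (\<lambda>z. f (case_prod (comb_seq k) z))"
    using assms by (intro integrable_distr[OF measurable_comb_seq]) (simp only: seq.PiM_comb_seq)
  then have int: "integrable (Seq \<Otimes>\<^sub>M Seq) (\<lambda>(v, w). f (comb_seq k v w))"
    by (simp add: case_prod_beta')
  show "integrable Seq (\<lambda>v. \<integral>w. f (comb_seq k v w) \<partial>Seq)"
    using P.integrable_fst'[OF int] by simp
  have "(\<integral>v. f v \<partial>Seq) = (\<integral>v. f v \<partial>distr (Seq \<Otimes>\<^sub>M Seq) Seq (\<lambda>(v, w). comb_seq k v w))"
    by (simp only: seq.PiM_comb_seq)
  also have "\<dots> = (\<integral>z. f (case_prod (comb_seq k) z) \<partial>(Seq \<Otimes>\<^sub>M Seq))"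
    using measurable_comb_seq assms by (intro integral_distr) auto
  also have "\<dots> = (\<integral>v. (\<integral>w. f (comb_seq k v w) \<partial>Seq) \<partial>Seq)"
    using P.integral_fst'[OF int] by (simp add: case_prod_beta')
  finally show "(\<integral>v. f v \<partial>Seq) = (\<integral>v. (\<integral>w. f (comb_seq k v w) \<partial>Seq) \<partial>Seq)" .
qed

lemma integral_Seq_component:
  fixes f :: "real \<Rightarrow> real"
  assumes "f \<in> borel_measurable borel"
  shows "(\<integral>v. f (v i) \<partial>Seq) = (\<integral>x. f x \<partial>M)"
proof -
  have "(\<integral>x. f x \<partial>M) = (\<integral>x. f x \<partial>distr Seq M (\<lambda>v. v i))"
    by (simp only: seq.PiM_component[OF UNIV_I])
  also have "\<dots> = (\<integral>v. f (v i) \<partial>Seq)"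
    using assms by (intro integral_distr) auto
  finally show ?thesis ..
qed

lemma integral_Seq_two_components:
  fixes h :: "real \<Rightarrow> real \<Rightarrow> real"
  assumes "i \<noteq> j" "integrable Seq (\<lambda>v. h (v 0) (v 1))"
    and [measurable]: "case_prod h \<in> borel_measurable (borel \<Otimes>\<^sub>M borel)"
  shows "(\<integral>v. h (v i) (v j) \<partial>Seq) = (\<integral>x. (\<integral>y. h x y \<partial>M) \<partial>M)"
proof -
  \<comment> \<open>Any injection with 0 to \<open>i\<close> and 1 to \<open>j\<close> serves; for n
    >= 2 the value n + i + j exceeds both.\<close>
  define \<sigma> where "\<sigma> n = (if n = 0 then i else if n = 1 then j else n + i + j)" for n :: nat
  have "inj \<sigma>" using assms(1) by (auto simp: inj_on_def \<sigma>_def split: if_splits)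
  from integral_Seq_reindex[OF this, of "\<lambda>v. h (v 0) (v 1)"] assms(2)
  have "(\<integral>v. h (v i) (v j) \<partial>Seq) = (\<integral>v. h (v 0) (v 1) \<partial>Seq)"
    by (simp add: \<sigma>_def)
  also have "\<dots> = (\<integral>v. (\<integral>w. h (v 0) (w 0) \<partial>Seq) \<partial>Seq)"
    using integral_Seq_comb_seq(1)[OF assms(2), of 1] by (simp add: comb_seq_def)
  also have "\<dots> = (\<integral>v. (\<integral>y. h (v 0) y \<partial>M) \<partial>Seq)"
    by (intro Bochner_Integration.integral_cong refl integral_Seq_component) measurable
  also have "\<dots> = (\<integral>x. (\<integral>y. h x y \<partial>M) \<partial>M)"
  proof (rule integral_Seq_component)
    have "(\<lambda>x. \<integral>y. h x y \<partial>M) \<in> borel_measurable M"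
      using assms(3) by (intro borel_measurable_lebesgue_integral) (simp cong: measurable_cong_sets)
    then show "(\<lambda>x. \<integral>y. h x y \<partial>M) \<in> borel_measurable borel" by simp
  qed
  finally show ?thesis .
qed

section \<open>Ghost sample, sign flips and the expected Kolmogorov-Smirnov distance\<close>

definition deviation :: "nat set \<Rightarrow> (nat \<Rightarrow> real) \<Rightarrow> real \<Rightarrow> real" where
  "deviation I v q = (\<Sum>i\<in>I. indicator {..q} (v i) - cdf M q)"

lemma abs_sum_le_card:
  fixes f :: "nat \<Rightarrow> real"
  assumes "\<And>i. i \<in> I \<Longrightarrow> \<bar>f i\<bar> \<le> 1"
  shows "\<bar>\<Sum>i\<in>I. f i\<bar> \<le> card I"
  using sum_bounded_above[of I "\<lambda>i. \<bar>f i\<bar>" 1] assms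
  by (intro order_trans[OF sum_abs]) simp

lemma abs_deviation_le: "\<bar>deviation I v q\<bar> \<le> card I"
  unfolding deviation_def using cdf_nonneg[of q] cdf_bounded_prob[of q]
  by (intro abs_sum_le_card) (auto simp: indicator_def)

lemma measurable_deviation: "(\<lambda>v. deviation I v q) \<in> borel_measurable Seq"
  unfolding deviation_def by measurable

lemma integrable_deviation: "integrable Seq (\<lambda>v. rat_sup_norm (deviation I v))"
  by (rule seq.P.integrable_rat_sup_norm[OF measurable_deviation abs_deviation_le])

lemma deviation_ghost:
  assumes "finite I"
  shows "deviation I v q = (\<integral>w. (\<Sum>i\<in>I. indicator {..q} (v i) - indicator {..q} (w i)) \<partial>Seq)"
proof -
  have int: "integrable Seq (\<lambda>w. indicator {..q} (w i) :: real)" for i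
    by (rule seq.P.integrable_const_bound[of _ 1]) (auto simp: indicator_def)
  have "(\<integral>w. indicator {..q} (w i) \<partial>Seq) = cdf M q" for i
    using integral_Seq_component[of "indicator {..q}" i] by (simp add: cdf_def)
  with int show ?thesis
    unfolding deviation_def by (simp add: seq.P.prob_space)
qed

text \<open>The ghost sample sits in the same sequence, shifted by \<open>m\<close>; for
  \<open>I\<close> below \<open>m\<close> the two blocks are disjoint. \<open>A = I\<close> makes
  all signs positive.\<close>

definition ghost :: "nat set \<Rightarrow> nat \<Rightarrow> nat set \<Rightarrow> (nat \<Rightarrow> real) \<Rightarrow> real \<Rightarrow> real" where
  "ghost I m A v q = (\<Sum>i\<in>I. rsign A i * (indicator {..q} (v i) - indicator {..q} (v (i + m))))"

lemma abs_ghost_le: "\<bar>ghost I m A v q\<bar> \<le> card I"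
  unfolding ghost_def by (intro abs_sum_le_card) (auto simp: indicator_def rsign_def)

lemma measurable_ghost: "(\<lambda>v. ghost I m A v q) \<in> borel_measurable Seq"
  unfolding ghost_def by measurable

lemma integrable_ghost: "integrable Seq (\<lambda>v. rat_sup_norm (ghost I m A v))"
  by (rule seq.P.integrable_rat_sup_norm[OF measurable_ghost abs_ghost_le])

text \<open>Jensen: \<open>deviation\<close> is the conditional mean of \<open>ghost\<close> given
  the sample, and the supremum of absolute means is at most the mean of the supremum.\<close>

lemma integral_deviation_le_ghost:
  assumes I: "I \<subseteq> {..<m}"
  shows "(\<integral>v. rat_sup_norm (deviation I v) \<partial>Seq) \<le> (\<integral>v. rat_sup_norm (ghost I m I v) \<partial>Seq)"
proof -
  have fin: "finite I" using I finite_subset by blast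
  have comb: "ghost I m I (comb_seq m v w) q = (\<Sum>i\<in>I. indicator {..q} (v i) - indicator {..q} (w i))"
    for v w q
    unfolding ghost_def using I by (intro sum.cong) (auto simp: rsign_def comb_seq_def)
  have meas: "(\<lambda>w. ghost I m I (comb_seq m v w) q) \<in> borel_measurable Seq" for v q
    unfolding comb by measurable
  have int: "integrable Seq (\<lambda>w. rat_sup_norm (ghost I m I (comb_seq m v w)))" for v
    by (rule seq.P.integrable_rat_sup_norm[OF meas abs_ghost_le])
  have "rat_sup_norm (deviation I v) \<le> (\<integral>w. rat_sup_norm (ghost I m I (comb_seq m v w)) \<partial>Seq)" for v
  proof (rule rat_sup_norm_least)
    fix q :: real assume q: "q \<in> \<rat>"
    have "integrable Seq (\<lambda>w. ghost I m I (comb_seq m v w) q)"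
      using meas abs_ghost_le by (intro seq.P.integrable_const_bound[of _ "card I"]) auto
    then have "integrable Seq (\<lambda>w. \<bar>ghost I m I (comb_seq m v w) q\<bar>)"
      by (rule integrable_abs)
    moreover have "\<bar>deviation I v q\<bar> \<le> (\<integral>w. \<bar>ghost I m I (comb_seq m v w) q\<bar> \<partial>Seq)"
      unfolding deviation_ghost[OF fin] comb by (rule integral_abs_bound)
    ultimately show "\<bar>deviation I v q\<bar> \<le> (\<integral>w. rat_sup_norm (ghost I m I (comb_seq m v w)) \<partial>Seq)"
      using int rat_sup_norm_upper[OF abs_ghost_le q]
      by (elim order_trans) (intro integral_mono)
  qed
  then have "(\<integral>v. rat_sup_norm (deviation I v) \<partial>Seq)
      \<le> (\<integral>v. (\<integral>w. rat_sup_norm (ghost I m I (comb_seq m v w)) \<partial>Seq) \<partial>Seq)"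
    by (intro integral_mono integrable_deviation integral_Seq_comb_seq(2) integrable_ghost)
  also have "\<dots> = (\<integral>v. rat_sup_norm (ghost I m I v) \<partial>Seq)"
    by (rule integral_Seq_comb_seq(1)[OF integrable_ghost, symmetric])
  finally show ?thesis .
qed

lemma integral_ghost_sign:
  assumes I: "I \<subseteq> {..<m}"
  shows "(\<integral>v. rat_sup_norm (ghost I m A v) \<partial>Seq) = (\<integral>v. rat_sup_norm (ghost I m I v) \<partial>Seq)"
proof -
  \<comment> \<open>The involution exchanging \<open>i\<close> and \<open>i + m\<close> for
    \<open>i\<close> in \<open>I - A\<close>: a swap with the ghost partner flips the sign of that
    summand and keeps the law.\<close>
  define \<sigma> where "\<sigma> j = (if j < m then if j \<in> I - A then j + m else j
    else if j - m \<in> I - A then j - m else j)" for j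
  have "\<sigma> (\<sigma> j) = j" for j using I by (auto simp: \<sigma>_def)
  then have "inj \<sigma>" by (rule inj_on_inverseI)
  have "ghost I m I (\<lambda>n. v (\<sigma> n)) = ghost I m A v" for v
    unfolding ghost_def fun_eq_iff using I
    by (intro allI sum.cong) (auto simp: \<sigma>_def rsign_def)
  moreover have "(\<lambda>v. rat_sup_norm (ghost I m I v)) \<in> borel_measurable Seq"
    using integrable_ghost by blast
  ultimately show ?thesis
    using integral_Seq_reindex[OF \<open>inj \<sigma>\<close>, of "\<lambda>v. rat_sup_norm (ghost I m I v)"] by simp
qed

definition signed :: "nat set \<Rightarrow> nat set \<Rightarrow> (nat \<Rightarrow> real) \<Rightarrow> real \<Rightarrow> real" where
  "signed I A v q = (\<Sum>i\<in>I. rsign A i * indicator {..q} (v i))"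

lemma abs_signed_le: "\<bar>signed I A v q\<bar> \<le> card I"
  unfolding signed_def by (intro abs_sum_le_card) (auto simp: indicator_def rsign_def)

lemma measurable_signed: "(\<lambda>v. signed I A v q) \<in> borel_measurable Seq"
  unfolding signed_def by measurable

lemma integrable_signed: "integrable Seq (\<lambda>v. rat_sup_norm (signed I A v))"
  by (rule seq.P.integrable_rat_sup_norm[OF measurable_signed abs_signed_le])

text \<open>Triangle inequality: sample and ghost sample contribute equally, having the same
  law.\<close>

lemma integral_ghost_le_signed:
  "(\<integral>v. rat_sup_norm (ghost I m A v) \<partial>Seq) \<le> 2 * (\<integral>v. rat_sup_norm (signed I A v) \<partial>Seq)"
proof -
  have ghost: "ghost I m A v q = signed I A v q - signed I A (\<lambda>n. v (n + m)) q" for v q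
    by (simp add: ghost_def signed_def right_diff_distrib sum_subtractf)
  have le: "rat_sup_norm (ghost I m A v)
      \<le> rat_sup_norm (signed I A v) + rat_sup_norm (signed I A (\<lambda>n. v (n + m)))" for v
  proof (rule rat_sup_norm_least)
    fix q :: real assume "q \<in> \<rat>"
    then show "\<bar>ghost I m A v q\<bar> \<le> rat_sup_norm (signed I A v) + rat_sup_norm (signed I A (\<lambda>n. v (n + m)))"
      using rat_sup_norm_upper[of "signed I A v", OF abs_signed_le]
        rat_sup_norm_upper[of "signed I A (\<lambda>n. v (n + m))", OF abs_signed_le]
      unfolding ghost by (meson abs_triangle_ineq4 add_mono order_trans)
  qed
  have meas: "(\<lambda>v. signed I A (\<lambda>n. v (n + m)) q) \<in> borel_measurable Seq" for q
    unfolding signed_def by measurable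
  have int: "integrable Seq (\<lambda>v. rat_sup_norm (signed I A (\<lambda>n. v (n + m))))"
    by (rule seq.P.integrable_rat_sup_norm[OF meas abs_signed_le])
  have "(\<integral>v. rat_sup_norm (signed I A (\<lambda>n. v (n + m))) \<partial>Seq) = (\<integral>v. rat_sup_norm (signed I A v) \<partial>Seq)"
    using integral_Seq_reindex[of "\<lambda>n. n + m" "\<lambda>v. rat_sup_norm (signed I A v)"] integrable_signed by simp
  moreover have "(\<integral>v. rat_sup_norm (ghost I m A v) \<partial>Seq)
      \<le> (\<integral>v. rat_sup_norm (signed I A v) + rat_sup_norm (signed I A (\<lambda>n. v (n + m))) \<partial>Seq)"
    using le by (intro integral_mono integrable_ghost Bochner_Integration.integrable_add integrable_signed int)
  ultimately show ?thesis
    using integrable_signed int by simp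
qed

text \<open>For a fixed sample only the signs are random, and the values \<open>v i\<close> provide
  the order of the walk.\<close>

lemma sum_signed_le:
  assumes "finite I"
  shows "(\<Sum>A\<in>Pow I. rat_sup_norm (signed I A v)) \<le> 2 ^ card I * (2 * sqrt (card I))"
proof -
  have "signed I A v q = (\<Sum>i\<in>{i\<in>I. v i \<le> q}. rsign A i)" for A q
    unfolding signed_def sum.inter_filter[OF assms] by (intro sum.cong) auto
  then show ?thesis
    unfolding rat_sup_norm_def using rademacher_maximal[OF assms Rats_nonempty, of v] by simp
qed

text \<open>The ghost expectation is the same for every sign pattern, so it may be averaged over all
  \<open>2 ^ card I\<close> of them. The constant 4 is 2 from the triangle inequality times 2 from
  the maximal inequality.\<close>

lemma integral_deviation_le:
  assumes "finite I"
  shows "(\<integral>v. rat_sup_norm (deviation I v) \<partial>Seq) \<le> 4 * sqrt (card I)"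
proof -
  from finite_nat_bounded[OF assms] obtain m where I: "I \<subseteq> {..<m}" by blast
  have "2 ^ card I * (\<integral>v. rat_sup_norm (deviation I v) \<partial>Seq)
      \<le> 2 ^ card I * (\<integral>v. rat_sup_norm (ghost I m I v) \<partial>Seq)"
    by (intro mult_left_mono integral_deviation_le_ghost[OF I]) simp
  also have "\<dots> = (\<Sum>A\<in>Pow I. \<integral>v. rat_sup_norm (ghost I m I v) \<partial>Seq)"
    using assms by (simp add: card_Pow)
  also have "\<dots> = (\<Sum>A\<in>Pow I. \<integral>v. rat_sup_norm (ghost I m A v) \<partial>Seq)"
    by (intro sum.cong refl integral_ghost_sign[OF I, symmetric])
  also have "\<dots> \<le> (\<Sum>A\<in>Pow I. 2 * (\<integral>v. rat_sup_norm (signed I A v) \<partial>Seq))"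
    by (intro sum_mono integral_ghost_le_signed)
  also have "\<dots> = 2 * (\<integral>v. (\<Sum>A\<in>Pow I. rat_sup_norm (signed I A v)) \<partial>Seq)"
    using integrable_signed by (subst Bochner_Integration.integral_sum) (auto simp: sum_distrib_left)
  also have "(\<integral>v. (\<Sum>A\<in>Pow I. rat_sup_norm (signed I A v)) \<partial>Seq)
      \<le> (\<integral>v. 2 ^ card I * (2 * sqrt (card I)) \<partial>Seq)"
    using integrable_signed by (intro integral_mono sum_signed_le assms) auto
  finally show ?thesis by (simp add: seq.P.prob_space)
qed

end

section \<open>Regret of Follow-the-rho\<close>

lemma gft_nonneg: "0 \<le> gft p x y"
  by (simp add: gft_def)

lemma gft_diag [simp]: "gft p x x = 0"
  by (simp add: gft_def)

lemma gft_le_1: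
  assumes "x \<in> {0..1}" "y \<in> {0..1}"
  shows "gft p x y \<le> 1"
  using assms by (auto simp: gft_def min_def max_def)

text \<open>|x - y| = x + y - 2 min x y, and on the unit interval the minimum is at least the
  product.\<close>

lemma gft_le_variance_form:
  assumes "x \<in> {0..1}" "y \<in> {0..1}"
  shows "gft p x y \<le> x + y - 2 * x * y"
proof -
  have "x * y \<le> x" "x * y \<le> y"
    using assms by (auto intro: mult_left_le mult_left_le_one_le)
  then show ?thesis by (auto simp: gft_def min_def max_def)
qed

section \<open>Regret of a single round\<close>

context unit_distribution
begin

definition expected_gft :: "real \<Rightarrow> real" where
  "expected_gft p = (\<integral>x. (\<integral>y. gft p x y \<partial>M) \<partial>M)"

lemma expected_gft_eq_rho: "p \<in> {0..1} \<Longrightarrow> expected_gft p = rho M p"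
  by (simp add: expected_gft_def rho_eq_integral_gft)

lemma AE_Seq_unit: "AE v in Seq. \<forall>i. v i \<in> {0..1}"
  unfolding AE_all_countable using seq.AE_component[OF UNIV_I AE_unit] by blast

lemma integrable_Seq_gft:
  assumes [measurable]: "P \<in> borel_measurable Seq"
  shows "integrable Seq (\<lambda>v. gft (P v) (v i) (v j))"
proof (rule seq.P.integrable_const_bound)
  show "AE v in Seq. norm (gft (P v) (v i) (v j)) \<le> 1"
    using AE_Seq_unit by eventually_elim (simp add: gft_nonneg gft_le_1)
qed measurable

lemma integral_Seq_gft:
  assumes "i \<noteq> j"
  shows "(\<integral>v. gft p (v i) (v j) \<partial>Seq) = expected_gft p"
proof -
  have "case_prod (gft p) \<in> borel_measurable (borel \<Otimes>\<^sub>M borel)"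
    unfolding case_prod_beta' by measurable
  then show ?thesis
    unfolding expected_gft_def
    by (intro integral_Seq_two_components assms integrable_Seq_gft) auto
qed

text \<open>Splitting at \<open>k\<close> freezes the price, while both valuations come from the
  independent continuation.\<close>

lemma integral_Seq_gft_adapted:
  assumes P: "P \<in> borel_measurable Seq" and past: "\<And>v w. P (comb_seq k v w) = P v"
    and ij: "k \<le> i" "k \<le> j" "i \<noteq> j"
  shows "(\<integral>v. gft (P v) (v i) (v j) \<partial>Seq) = (\<integral>v. expected_gft (P v) \<partial>Seq)"
    and "integrable Seq (\<lambda>v. expected_gft (P v))"
proof -
  have eq: "(\<integral>w. gft (P (comb_seq k v w)) (comb_seq k v w i) (comb_seq k v w j) \<partial>Seq)
      = expected_gft (P v)" for v
    using integral_Seq_gft[of "i - k" "j - k" "P v"] ij by (simp add: past comb_seq_def)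
  note int = integrable_Seq_gft[OF P, of i j]
  show "(\<integral>v. gft (P v) (v i) (v j) \<partial>Seq) = (\<integral>v. expected_gft (P v) \<partial>Seq)"
    using integral_Seq_comb_seq(1)[OF int, of k] by (simp add: eq)
  show "integrable Seq (\<lambda>v. expected_gft (P v))"
    using integral_Seq_comb_seq(2)[OF int, of k] by (simp add: eq)
qed

text \<open>With mean m, independence turns \<open>gft_le_variance_form\<close> into 2 m - 2 m^2,
  which is largest at m = 1/2. This serves both the first round and the bias term.\<close>

lemma expected_gft_le_half: "expected_gft p \<le> 1/2"
proof -
  have int: "integrable Seq (\<lambda>v. v i)" for i
  proof (rule seq.P.integrable_const_bound)
    show "AE v in Seq. norm (v i) \<le> 1"
      using AE_Seq_unit by eventually_elim simp
  qed measurable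
  have int2: "integrable Seq (\<lambda>v. v i * v j)" for i j
  proof (rule seq.P.integrable_const_bound)
    show "AE v in Seq. norm (v i * v j) \<le> 1"
      using AE_Seq_unit by eventually_elim (simp add: abs_mult mult_le_one)
  qed measurable
  define m where "m = mean_of M"
  have mean: "(\<integral>v. v i \<partial>Seq) = m" for i
    using integral_Seq_component[of "\<lambda>x. x" i] by (simp add: m_def mean_of_def)
  have "(\<integral>v. v 0 * v 1 \<partial>Seq) = (\<integral>x. (\<integral>y. x * y \<partial>M) \<partial>M)"
    using int2[of 0 1] by (intro integral_Seq_two_components) (auto simp: case_prod_beta')
  also have "\<dots> = m * m" by (simp add: m_def mean_of_def)
  finally have prod: "(\<integral>v. v 0 * v 1 \<partial>Seq) = m * m" .
  have "expected_gft p = (\<integral>v. gft p (v 0) (v 1) \<partial>Seq)"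
    by (simp add: integral_Seq_gft)
  also have "\<dots> \<le> (\<integral>v. v 0 + v 1 - 2 * (v 0 * v 1) \<partial>Seq)"
  proof (rule integral_mono_AE)
    show "AE v in Seq. gft p (v 0) (v 1) \<le> v 0 + v 1 - 2 * (v 0 * v 1)"
      using AE_Seq_unit by eventually_elim (use gft_le_variance_form[of _ _ p] in \<open>simp add: mult.assoc\<close>)
  qed (use int int2 in \<open>auto intro!: integrable_Seq_gft\<close>)
  also have "\<dots> = m + m - 2 * (m * m)"
    using int int2 prod by (simp add: mean)
  also have "\<dots> \<le> 1/2"
    using zero_le_power2[of "m - 1/2"] by (simp add: power2_eq_square algebra_simps)
  finally show ?thesis .
qed

text \<open>The empirical average is a V-statistic: its \<open>n\<close> diagonal terms vanish, hence the factor \<open>1 - 1/n\<close>.\<close>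
lemma integral_empirical_gft:
  assumes "n > 0"
  shows "(\<integral>v. (\<Sum>i<n. \<Sum>j<n. gft p (v (Suc i)) (v (Suc j))) / (real n)\<^sup>2 \<partial>Seq)
    = expected_gft p - expected_gft p / n"
proof -
  have "(\<integral>v. gft p (v (Suc i)) (v (Suc j)) \<partial>Seq) = (if i = j then 0 else expected_gft p)" for i j
    by (simp add: integral_Seq_gft)
  then have "(\<integral>v. (\<Sum>i<n. \<Sum>j<n. gft p (v (Suc i)) (v (Suc j))) / (real n)\<^sup>2 \<partial>Seq)
      = (\<Sum>i<n. \<Sum>j<n. if i = j then 0 else expected_gft p) / (real n)\<^sup>2"
    by (simp add: integrable_Seq_gft)
  also have "(\<Sum>i<n. \<Sum>j<n. if i = j then 0 else expected_gft p)
      = (\<Sum>i<n. \<Sum>j<n. expected_gft p - (if i = j then expected_gft p else 0))"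
    by (intro sum.cong) auto
  also have "\<dots> = real n * (real n * expected_gft p - expected_gft p)"
    by (simp add: sum_subtractf)
  finally show ?thesis using assms by (simp add: power2_eq_square field_simps)
qed

lemma rho_diff_empirical:
  assumes "n > 0" "\<And>i. v i \<in> {0..1}" "p \<in> {0..1}"
  shows "\<bar>rho (emp (map v [1..<Suc n])) p - rho M p\<bar> \<le> 4 * (rat_sup_norm (deviation {1..n} v) / n)"
proof -
  define xs where "xs = map v [1..<Suc n]"
  have xs: "length xs = n" "xs \<noteq> []" "\<And>i. i < n \<Longrightarrow> xs ! i = v (Suc i)" "set xs \<subseteq> {0..1}"
    using assms(1,2) by (auto simp: xs_def simp del: upt_Suc)
  have "unit_distribution M" ..
  moreover have "\<bar>cdf (emp_borel xs) q - cdf M q\<bar> \<le> rat_sup_norm (deviation {1..n} v) / n" if "q \<in> \<rat>" for q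
  proof -
    have "deviation {1..n} v q = (\<Sum>i<n. indicator {..q} (v (Suc i)) - cdf M q)"
      unfolding deviation_def by (rule sum.reindex_bij_witness[of _ Suc "\<lambda>i. i - 1"]) auto
    then have "cdf (emp_borel xs) q - cdf M q = deviation {1..n} v q / n"
      using assms(1) xs by (simp add: cdf_emp_borel sum_subtractf field_simps)
    then show ?thesis
      using rat_sup_norm_upper[of "deviation {1..n} v", OF abs_deviation_le that]
      by (simp add: divide_right_mono)
  qed
  ultimately have "\<bar>rho (emp_borel xs) p - rho M p\<bar> \<le> 4 * (rat_sup_norm (deviation {1..n} v) / n)"
    using unit_distribution_emp_borel[OF xs(2,4)] assms(3) by (intro rho_diff_le)
  then show ?thesis by (simp add: rho_emp_borel xs_def)
qed

text \<open>The fixed price p is compared in expectation, at the cost of the bias alone; only the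
  random price pays for the uniform deviation, so 4 D enters once. The terms are (1/2)/n and 4 * 4
  sqrt n / n.\<close>

lemma ftrho_round_regret:
  assumes sel: "ftrho_selection sel" and n: "n > 0" "even n" and p: "p \<in> {0..1}"
    and int: "integrable Seq (\<lambda>v. expected_gft (sel (map v [1..<Suc n])))"
  shows "expected_gft p - (\<integral>v. expected_gft (sel (map v [1..<Suc n])) \<partial>Seq)
    \<le> 1 / (2 * real n) + 16 / sqrt n"
proof -
  define W where "W v = (\<Sum>i<n. \<Sum>j<n. gft p (v (Suc i)) (v (Suc j))) / (real n)\<^sup>2" for v :: "nat \<Rightarrow> real"
  define D where "D v = rat_sup_norm (deviation {1..n} v)" for v
  define P where "P v = sel (map v [1..<Suc n])" for v
  have intW: "integrable Seq W" unfolding W_def by (simp add: integrable_Seq_gft)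
  have intD: "integrable Seq D" unfolding D_def by (rule integrable_deviation)
  have intP: "integrable Seq (\<lambda>v. expected_gft (P v))" using int by (simp only: P_def)
  \<comment> \<open>W v = rho(emp)(p) <= rho(emp)(P v) <= rho(M)(P v) + 4 D v / n, the middle step
    by the choice of \<open>P v\<close>.\<close>
  have pointwise: "W v - 4 * (D v / n) \<le> expected_gft (P v)"
    if unit: "\<forall>i. v i \<in> {0..1}" for v
  proof -
    define xs where "xs = map v [1..<Suc n]"
    have xs: "length xs = n" "xs \<noteq> []" "\<And>i. i < n \<Longrightarrow> xs ! i = v (Suc i)" "set xs \<subseteq> {0..1}"
      using n unit by (auto simp: xs_def simp del: upt_Suc)
    have opt: "P v \<in> {0..1}" "rho (emp xs) p \<le> rho (emp xs) (P v)"
      using sel xs n p unfolding ftrho_selection_def P_def xs_def[symmetric] by auto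
    have "rho (emp xs) p = W v"
      using rho_emp_eq_sum[OF xs(2,4) p] xs by (simp add: W_def)
    moreover have "\<bar>rho (emp xs) (P v) - rho M (P v)\<bar> \<le> 4 * (D v / n)"
      unfolding D_def xs_def using n unit opt(1) by (intro rho_diff_empirical) auto
    ultimately show ?thesis
      using opt by (simp add: expected_gft_eq_rho p abs_le_iff)
  qed
  have "(\<integral>v. W v - 4 * (D v / n) \<partial>Seq) \<le> (\<integral>v. expected_gft (P v) \<partial>Seq)"
    using AE_Seq_unit intW intD intP pointwise
    by (intro integral_mono_AE) (auto elim!: eventually_mono)
  also have "(\<integral>v. W v - 4 * (D v / n) \<partial>Seq)
      = (\<integral>v. W v \<partial>Seq) - 4 * ((\<integral>v. D v \<partial>Seq) / n)"
    using intW intD by (simp add: seq.P.prob_space)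
  also have "(\<integral>v. W v \<partial>Seq) = expected_gft p - expected_gft p / n"
    unfolding W_def by (rule integral_empirical_gft[OF n(1)])
  finally have le: "expected_gft p - (\<integral>v. expected_gft (P v) \<partial>Seq)
      \<le> expected_gft p / n + 4 * ((\<integral>v. D v \<partial>Seq) / n)" by simp
  have "expected_gft p / n \<le> 1/2 / n"
    by (intro divide_right_mono expected_gft_le_half) simp
  moreover have "(\<integral>v. D v \<partial>Seq) / n \<le> 4 * sqrt n / n"
    using integral_deviation_le[of "{1..n}"] by (intro divide_right_mono) (simp_all add: D_def)
  moreover have "4 * sqrt n / n = 4 / sqrt n"
    using n by (simp add: field_simps)
  ultimately show ?thesis
    using le by (simp add: P_def)
qed


lemma ftrho_round:
  assumes sel: "ftrho_selection sel" and meas: "ftrho_price sel t \<in> borel_measurable Seq"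
    and p: "p \<in> {0..1}" and t: "t \<ge> 1"
  shows "expected_gft p - (\<integral>v. gft (ftrho_price sel t v) (v (2*t-1)) (v (2*t)) \<partial>Seq)
    \<le> (if t = 1 then 1/2 else (6 * sqrt pi + 2 * sqrt 2) / sqrt (real (t - 1)))"
proof (cases "t = 1")
  case True
  have "0 \<le> (\<integral>v. gft (ftrho_price sel t v) (v (2*t-1)) (v (2*t)) \<partial>Seq)"
    by (intro integral_nonneg_AE AE_I2 gft_nonneg)
  then show ?thesis using expected_gft_le_half[of p] True by simp
next
  case False
  define k where "k = real (t - 1)"
  have k: "k \<ge> 1" using t False by (simp add: k_def)
  \<comment> \<open>The number of valuations seen before round t. They are numbered from 1, so the
    past ends at index \<open>n\<close> and splitting takes place at \<open>Suc n\<close>.\<close>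
  define n where "n = 2 * t - 2"
  have n: "n > 0" "even n" "real n = 2 * k" "2 * t - 1 = Suc n"
    using t False by (auto simp: n_def k_def of_nat_diff)
  have price: "ftrho_price sel t = (\<lambda>v. sel (map v [1..<Suc n]))"
    unfolding ftrho_price_def n(4) using t False by (auto simp del: upt_Suc)
  have past: "ftrho_price sel t (comb_seq (2*t-1) v w) = ftrho_price sel t v" for v w
  proof -
    have "map (comb_seq (Suc n) v w) [1..<Suc n] = map v [1..<Suc n]"
      by (intro map_cong) (auto simp: comb_seq_def)
    then show ?thesis by (simp only: price n(4))
  qed
  note * = integral_Seq_gft_adapted[OF meas past, of "2*t-1" "2*t"]
  have "expected_gft p - (\<integral>v. gft (ftrho_price sel t v) (v (2*t-1)) (v (2*t)) \<partial>Seq)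
      \<le> 1 / (2 * real n) + 16 / sqrt n"
    using ftrho_round_regret[OF sel n(1,2) p] * t by (simp add: price del: upt_Suc)
  also have "\<dots> = 1 / (4 * k) + 8 * (2 / sqrt 2) / sqrt k"
    by (simp add: n(3) real_sqrt_mult)
  also have "2 / sqrt 2 = sqrt 2"
    by (rule real_div_sqrt) simp
  also have "1 / (4 * k) \<le> 1/4 / sqrt k"
  proof -
    have "sqrt k * 1 \<le> sqrt k * sqrt k" using k by (intro mult_left_mono) auto
    then have "sqrt k \<le> k" using k by simp
    then show ?thesis using k by (simp add: field_simps)
  qed
  also have "1/4 / sqrt k + 8 * sqrt 2 / sqrt k = (1/4 + 8 * sqrt 2) / sqrt k"
    by (simp add: add_divide_distrib)
  also have "\<dots> \<le> (6 * sqrt pi + 2 * sqrt 2) / sqrt k"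
  proof (rule divide_right_mono)
    \<comment> \<open>After cancelling 2 sqrt 2, the claim 1/4 + 6 sqrt 2 <= 6 sqrt pi follows from
      9.25 <= 10.2.\<close>
    have "17/10 \<le> sqrt pi" using pi_ge_two pi_gt3 by (intro real_le_rsqrt) (simp add: power2_eq_square)
    moreover have "sqrt 2 \<le> 3/2" by (intro real_le_lsqrt) (simp_all add: power2_eq_square)
    ultimately show "1/4 + 8 * sqrt 2 \<le> 6 * sqrt pi + 2 * sqrt 2" by simp
  qed (use k in simp)
  finally show ?thesis using False by (simp add: k_def)
qed

end

section \<open>Summation over the rounds\<close>

lemma sum_inverse_sqrt_le:
  fixes c :: real
  assumes "c \<ge> 0"
  shows "(\<Sum>t=1..T. if t = 1 then 1/2 else c / sqrt (real (t - 1))) \<le> 1/2 + 2 * c * sqrt (real (T - 1))"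
proof (induction T)
  case (Suc T)
  show ?case
  proof (cases "T = 0")
    case False
    define a b where "a = sqrt (real T)" and "b = sqrt (real (T - 1))"
    have ab: "a > 0" "b \<ge> 0" "a\<^sup>2 - b\<^sup>2 = 1" using False by (auto simp: a_def b_def of_nat_diff)
    \<comment> \<open>2 a (a - b) = (a^2 - b^2) + (a - b)^2, so 1/a is at most 2 (a - b), which
      telescopes.\<close>
    have "1 \<le> 2 * a * (a - b)"
      using ab zero_le_power2[of "a - b"] by (simp add: power2_eq_square algebra_simps)
    then have "c * (1 / a) \<le> c * (2 * (a - b))"
      using ab assms by (intro mult_left_mono) (simp_all add: field_simps)
    then have "c / a \<le> 2 * c * a - 2 * c * b" by (simp add: algebra_simps)
    then show ?thesis using Suc False by (simp add: a_def b_def)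
  qed simp
qed simp

theorem theorem5p1:
  fixes \<nu> :: "real measure" and sel :: "real list \<Rightarrow> real" and T :: nat
  assumes "prob_space \<nu>"
    and "sets \<nu> = sets borel"
    and "measure \<nu> {0..1} = 1"
    and "ftrho_selection sel"
    and "\<forall>t. (\<lambda>v. ftrho_price sel t v) \<in> borel_measurable (PiM UNIV (\<lambda>_::nat. \<nu>))"
  shows "regret \<nu> (ftrho_price sel) T \<le> 1/2 + 4 * (3 * sqrt pi + sqrt 2) * sqrt (real (T - 1))"
proof -
  interpret unit_distribution \<nu>
    using assms(1,2) prob_space.AE_prob_1[OF assms(1,3)]
    by (simp add: unit_distribution_def unit_distribution_axioms_def real_distribution_def
        real_distribution_axioms_def)
  \<comment> \<open>Half of the constant in the claim, since summing 1 / sqrt (t - 1) doubles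
    it.\<close>
  define c where "c = 6 * sqrt pi + 2 * sqrt 2"
  have c: "c \<ge> 0" by (simp add: c_def)
  define r where "r t = (\<integral>v. gft (ftrho_price sel t v) (v (2*t-1)) (v (2*t)) \<partial>Seq)" for t
  have price: "(\<integral>v. (\<Sum>t=1..T. gft (ftrho_price sel t v) (v (2*t-1)) (v (2*t))) \<partial>Seq) = (\<Sum>t=1..T. r t)"
    unfolding r_def using assms(5) by (intro Bochner_Integration.integral_sum integrable_Seq_gft) auto
  have "(SUP p\<in>{0..1}. \<integral>v. (\<Sum>t=1..T. gft p (v (2*t-1)) (v (2*t))) \<partial>Seq)
      \<le> 1/2 + 2 * c * sqrt (real (T - 1)) + (\<Sum>t=1..T. r t)"
  \<comment> \<open>The bound on each round does not depend on p, so it passes to the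
    supremum.\<close>
  proof (rule cSUP_least)
    fix p :: real assume p: "p \<in> {0..1}"
    have "(\<integral>v. (\<Sum>t=1..T. gft p (v (2*t-1)) (v (2*t))) \<partial>Seq)
        = (\<Sum>t=1..T. \<integral>v. gft p (v (2*t-1)) (v (2*t)) \<partial>Seq)"
      by (intro Bochner_Integration.integral_sum integrable_Seq_gft) auto
    also have "\<dots> = (\<Sum>t=1..T. expected_gft p)"
      by (intro sum.cong refl integral_Seq_gft) auto
    also have "\<dots> \<le> (\<Sum>t=1..T. (if t = 1 then 1/2 else c / sqrt (real (t - 1))) + r t)"
    proof (rule sum_mono)
      fix t assume "t \<in> {1..T}"
      then show "expected_gft p \<le> (if t = 1 then 1/2 else c / sqrt (real (t - 1))) + r t"
        using ftrho_round[OF assms(4) _ p, of t] assms(5) unfolding r_def c_def by fastforce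
    qed
    also have "\<dots> \<le> 1/2 + 2 * c * sqrt (real (T - 1)) + (\<Sum>t=1..T. r t)"
      unfolding sum.distrib by (intro add_right_mono sum_inverse_sqrt_le c)
    finally show "(\<integral>v. (\<Sum>t=1..T. gft p (v (2*t-1)) (v (2*t))) \<partial>Seq) \<le> \<dots>" .
  qed simp
  then show ?thesis
    unfolding regret_def price by (simp add: c_def algebra_simps)
qed

end
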